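(* Let the data satisfy the standing assumptions (1)-(3) of the context, and let $\Delta t\in(0,\overline{\Delta t}]$ and a mesh of size $\Delta x$ be fixed. Then the operators $\mathcal S_{k,i}$ defined in the context satisfy: (i) (Monotonicity) For all $U,V:\mathcal G_{\Delta x}\to\mathbb{R}$ with $U\le V$, we have $\mathcal S_{k,i}[U]\le\mathcal S_{k,i}[V]$ (pointwise on $A\times B$) for all $k\in\mathcal I_{\Delta t}^*$ and $i\in\mathcal I_{\Delta x}$. (ii) (Commutation by constant) For any $c\in\mathbb{R}$ and $U:\mathcal G_{\Delta x}\to\mathbb{R}$, $\mathcal S_{k,i}[U+c]=\mathcal S_{k,i}[U]+c$ for all $k\in\mathcal I_{\Delta t}^*$ and $i\in\mathcal I_{\Delta x}$.
   Context: **Data and standing assumptions.** $T>0$; $A\subset\mathbb{R}^{N_A}$, $B\subset\mathbb{R}^{N_B}$ are nonempty compact sets; $\mathcal V\subseteq\mathbb{R}^{N_B}$ is open with $B\subset\mathcal V$; $1\le N_\sigma\le N$; $\sigma:[0,T]\times\overline{\mathcal{O}}\times A\to\mathbb{R}^{N\times N_\sigma}$ with columns $\sigma^1,\dots,\sigma^{N_\sigma}$; $\mu:[0,T]\times\overline{\mathcal{O}}\times A\to\mathbb{R}^N$; $f:[0,T]\times\overline{\mathcal{O}}\times A\to\mathbb{R}$; $\gamma:\partial\mathcal{O}\times\mathcal V\to\mathbb{R}^N$, written $\gamma_b(x)=\gamma(x,b)$; $g:[0,T]\times\partial\mathcal{O}\times B\to\mathbb{R}$; $\Psi:\overline{\mathcal{O}}\to\mathbb{R}$.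 (1) $\mathcal{O}\subseteq\mathbb{R}^N$ ($1\le N\le3$) is a nonempty bounded domain with boundary of class $C^3$; $n(x)$ is the unit outward normal at $x\in\partial\mathcal{O}$. (2) $\sigma,\mu,f,g,\Psi$ are continuous, and $\sigma(\cdot,\cdot,a)$, $\mu(\cdot,\cdot,a)$ are Lipschitz with constants independent of $a\in A$. (3) $\gamma$ is of class $C^1$, and $|\gamma_b(x)|=1$, $\langle n(x),\gamma_b(x)\rangle>0$ for all $(x,b)\in\partial\mathcal{O}\times B$. **Meshes and interpolation.** For each mesh size $\Delta x>0$ under consideration (ranging over a set of positive numbers accumulating at $0$), a polyhedral domain $\mathcal{O}_{\Delta x}\subseteq\mathbb{R}^N$ is given with a triangulation $\mathbb{T}_{\Delta x}$ into simplices $\mathsf T$ with vertex set $\mathcal G_{\Delta x}=\{x_i: i\in\mathcal I_{\Delta x}\}$, $\mathcal I_{\Delta x}=\{1,\dots,N_{\Delta x}\}$, such that: $\Delta x$ is the maximum of the diameters of the simplices; all vertices on $\partial\mathcal{O}_{\Delta x}$ lie on $\partial\mathcal{O}$; at most one face of each element with vertices on $\partial\mathcal{O}_{\Delta x}$ intersects $\partial\mathcal{O}_{\Delta x}$; there is $\delta\in(0,1)$ independent of $\Delta x$ such that each $\mathsf T$ is contained in a ball of radius $\Delta x/\delta$ and contains a ball of radius $\delta\Delta x$. There is also an exact triangulation $\widehat{\mathbb{T}}_{\Delta x}$ of $\overline{\mathcal{O}}$, $\overline{\mathcal{O}}=\bigcup\widehat{\mathsf T}$, with vertices in $\mathcal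 G_{\Delta x}$, whose elements correspond one-to-one to those of $\mathbb{T}_{\Delta x}$ with the same vertices; only boundary elements may be curved. The map $p_{\Delta x}:\overline{\mathcal{O}}\to\overline{\mathcal{O}}_{\Delta x}\cap\overline{\mathcal{O}}$ is $p_{\Delta x}(x)=p_{\mathsf T}(x)$ for $x\in\widehat{\mathsf T}$, where $\mathsf T$ has the same vertices as $\widehat{\mathsf T}$ and $p_{\mathsf T}$ is the projection onto $\mathsf T$. The domains approximate $\mathcal{O}$ to second order: there is $C>0$ independent of $\Delta x$ with $|x-p_{\Delta x}(x)|\le C(\Delta x)^2$ for all $x\in\overline{\mathcal{O}}$. Let $\psi_i$ be the $\mathbb{P}_1$ basis functions on $\mathbb{T}_{\Delta x}$ (continuous, affine on each $\mathsf T$, $\psi_i(x_j)=\delta_{ij}$, so $0\le\psi_i\le1$ and $\sum_i\psi_i=1$). For $\phi:\mathcal G_{\Delta x}\to\mathbb{R}$, $I[\phi](x)=\sum_{i\in\mathcal I_{\Delta x}}\psi_i(p_{\Delta x}(x))\phi(x_i)$, $x\in\overline{\mathcal{O}}$. **Scheme operators.** For $\Delta t>0$: $N_{\Delta t}=\lfloor T/\Delta t\rfloor$, $t_k=k\Delta t$, $\mathcal I_{\Delta t}^*=\{0,\dots,N_{\Delta t}-1\}$. For $\ell=1,\dots,N_\sigma$, $y_{k,i}^{\pm,\ell}(a)=x_i+\Delta t\,\mu(t_k,x_i,a)\pm\sqrt{N_\sigma\Delta t}\,\sigma^\ell(t_k,x_i,a)$; $\mathcal I=\{+,-\}\times\{1,\dots,N_\sigma\}$;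 $\bar c>0$ is a fixed constant. For some (small) $R>0$ there are uniquely determined $C^1$ functions $(x,b)\mapsto p^{\gamma_b}(x)\in\partial\mathcal{O}$ and $(x,b)\mapsto d^{\gamma_b}(x)\in\mathbb{R}$ on $\{x: d(x,\partial\mathcal{O})<R\}\times B$ with $x=p^{\gamma_b}(x)+d^{\gamma_b}(x)\gamma_b(p^{\gamma_b}(x))$ and $d^{\gamma_b}=0$ on $\partial\mathcal{O}$. There is $\overline{\Delta t}>0$ such that for all $\Delta t\in(0,\overline{\Delta t}]$ the following is well defined, for $k\in\mathcal I_{\Delta t}^*$, $i\in\mathcal I_{\Delta x}$, $a\in A$, $b\in B$, $s\in\mathcal I$: if $y_{k,i}^s(a)\in\overline{\mathcal{O}}$, then $\tilde y_{k,i}^s(a,b)=y_{k,i}^s(a)$, $\tilde d_{k,i}^s(a,b)=0$, $\tilde g_{k,i}^s(a,b)=0$; otherwise, with $y=y_{k,i}^s(a)$, $\tilde y_{k,i}^s(a,b)=p^{\gamma_b}(y)-\bar c\sqrt{\Delta t}\,\gamma_b(p^{\gamma_b}(y))\in\overline{\mathcal{O}}$, $\tilde d_{k,i}^s(a,b)=d^{\gamma_b}(y)+\bar c\sqrt{\Delta t}$, $\tilde g_{k,i}^s(a,b)=g(t_k,p^{\gamma_b}(y),b)$. For $\Phi:\mathcal G_{\Delta x}\to\mathbb{R}$, $\mathcal S_{k,i}[\Phi]:A\times B\to\mathbb{R}$ is $$\mathcal S_{k,i}[\Phi](a,b)=\frac1{2N_\sigma}\sum_{s\in\mathcal I}\left[I[\Phi](\tilde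 y_{k,i}^s(a,b))+\tilde d_{k,i}^s(a,b)\tilde g_{k,i}^s(a,b)\right]+\Delta t\,f(t_k,x_i,a).$$ *)

theory Defs
  imports "HOL-Analysis.Analysis"
begin

section \<open>Functions of class \<open>C\<^sup>k\<close> and domains with smooth boundary\<close>

text \<open>Intended for open \<open>S\<close> in a finite-dimensional space; there, continuity of the iterated
  directional derivatives is continuity of the Frechet derivatives.\<close>

primrec Ck_on :: "nat \<Rightarrow> 'a::real_normed_vector set \<Rightarrow> ('a \<Rightarrow> 'b::real_normed_vector) \<Rightarrow> bool" where
  "Ck_on 0 S f \<longleftrightarrow> continuous_on S f"
| "Ck_on (Suc k) S f \<longleftrightarrow>
     (\<forall>x\<in>S. f differentiable (at x)) \<and> (\<forall>v. Ck_on k S (\<lambda>x. frechet_derivative f (at x) v))"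

text \<open>Class \<open>C\<^sup>k\<close> on a set that need not be open (a boundary times an open set, a tube times a
  compact set): local extendability to a \<open>C\<^sup>k\<close> function on an open set. On an embedded
  submanifold this is the intrinsic notion.\<close>

definition Ck_on_subset ::
    "nat \<Rightarrow> 'a::real_normed_vector set \<Rightarrow> ('a \<Rightarrow> 'b::real_normed_vector) \<Rightarrow> bool" where
  "Ck_on_subset k S f \<longleftrightarrow>
     (\<forall>x\<in>S. \<exists>U F. open U \<and> x \<in> U \<and> Ck_on k U F \<and> (\<forall>y\<in>U \<inter> S. F y = f y))"

text \<open>Near \<open>x\<close>, the set \<open>\<Omega>\<close> is the strict epigraph of \<open>h\<close> in the direction of the unit vector
  \<open>e\<close>. Only the values of \<open>h\<close> on the hyperplane orthogonal to \<open>e\<close> matter.\<close>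

definition boundary_chart ::
    "nat \<Rightarrow> 'a::euclidean_space set \<Rightarrow> 'a \<Rightarrow> real \<Rightarrow> 'a \<Rightarrow> ('a \<Rightarrow> real) \<Rightarrow> bool" where
  "boundary_chart k \<Omega> x r e h \<longleftrightarrow> 0 < r \<and> norm e = 1 \<and> Ck_on k UNIV h \<and>
     \<Omega> \<inter> ball x r = {y \<in> ball x r. h (y - (y \<bullet> e) *\<^sub>R e) < y \<bullet> e}"

definition Ck_boundary :: "nat \<Rightarrow> 'a::euclidean_space set \<Rightarrow> bool" where
  "Ck_boundary k \<Omega> \<longleftrightarrow> (\<forall>x\<in>frontier \<Omega>. \<exists>r e h. boundary_chart k \<Omega> x r e h)"

text \<open>The normalised gradient at \<open>x\<close> of the function which, in a chart, is negative exactly in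
  \<open>\<Omega>\<close>. The gradient \<open>G\<close> cannot vanish, since \<open>G \<bullet> e = - 1\<close>.\<close>

definition outward_unit_normal :: "'a::euclidean_space set \<Rightarrow> 'a \<Rightarrow> 'a \<Rightarrow> bool" where
  "outward_unit_normal \<Omega> x \<nu> \<longleftrightarrow> (\<exists>r e h G. boundary_chart 1 \<Omega> x r e h \<and>
     ((\<lambda>y. h (y - (y \<bullet> e) *\<^sub>R e) - y \<bullet> e) has_derivative (\<lambda>v. G \<bullet> v)) (at x) \<and>
     \<nu> = G /\<^sub>R norm G)"


section \<open>Data of the problem\<close>

text \<open>The dimensions \<open>N\<close>, \<open>N\<^sub>\<sigma>\<close>, \<open>N\<^sub>A\<close>, \<open>N\<^sub>B\<close> are the cardinalities of the index types
  \<open>'n\<close>, \<open>'m\<close>, \<open>'p\<close>, \<open>'q\<close>. The functions are total; only their values on the domains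
  named in the assumptions below are meaningful.\<close>

record ('n, 'm, 'p, 'q) control_data =
  horizon :: real
  domO :: "(real^'n) set"
  setA :: "(real^'p) set"
  setB :: "(real^'q) set"
  setV :: "(real^'q) set"
  sigma :: "real \<Rightarrow> real^'n \<Rightarrow> real^'p \<Rightarrow> real^'m^'n"
  mu :: "real \<Rightarrow> real^'n \<Rightarrow> real^'p \<Rightarrow> real^'n"
  fcost :: "real \<Rightarrow> real^'n \<Rightarrow> real^'p \<Rightarrow> real"
  gamma :: "real^'n \<Rightarrow> real^'q \<Rightarrow> real^'n"
  gcost :: "real \<Rightarrow> real^'n \<Rightarrow> real^'q \<Rightarrow> real"
  Psi :: "real^'n \<Rightarrow> real"
  normal :: "real^'n \<Rightarrow> real^'n"

definition basic_data :: "('n::finite, 'm::finite, 'p::finite, 'q::finite) control_data \<Rightarrow> bool" where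
  "basic_data D \<longleftrightarrow> 0 < horizon D \<and> CARD('m) \<le> CARD('n) \<and>
     setA D \<noteq> {} \<and> compact (setA D) \<and> setB D \<noteq> {} \<and> compact (setB D) \<and>
     open (setV D) \<and> setB D \<subseteq> setV D"

definition domain_assumption ::
    "('n::finite, 'm::finite, 'p::finite, 'q::finite) control_data \<Rightarrow> bool" where
  "domain_assumption D \<longleftrightarrow> CARD('n) \<le> 3 \<and>
     domO D \<noteq> {} \<and> open (domO D) \<and> connected (domO D) \<and> bounded (domO D) \<and>
     Ck_boundary 3 (domO D) \<and>
     (\<forall>x\<in>frontier (domO D). outward_unit_normal (domO D) x (normal D x))"

definition coefficient_assumption ::
    "('n::finite, 'm::finite, 'p::finite, 'q::finite) control_data \<Rightarrow> bool" where
  "coefficient_assumption D \<longleftrightarrow>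
     (let I = {0..horizon D}; Q = closure (domO D) in
       continuous_on (I \<times> Q \<times> setA D) (\<lambda>(t, x, a). sigma D t x a) \<and>
       continuous_on (I \<times> Q \<times> setA D) (\<lambda>(t, x, a). mu D t x a) \<and>
       continuous_on (I \<times> Q \<times> setA D) (\<lambda>(t, x, a). fcost D t x a) \<and>
       continuous_on (I \<times> frontier (domO D) \<times> setB D) (\<lambda>(t, x, b). gcost D t x b) \<and>
       continuous_on Q (Psi D) \<and>
       (\<exists>L. \<forall>a\<in>setA D. L-lipschitz_on (I \<times> Q) (\<lambda>(t, x). sigma D t x a)) \<and>
       (\<exists>L. \<forall>a\<in>setA D. L-lipschitz_on (I \<times> Q) (\<lambda>(t, x). mu D t x a)))"

definition oblique_assumption ::
    "('n::finite, 'm::finite, 'p::finite, 'q::finite) control_data \<Rightarrow> bool" where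
  "oblique_assumption D \<longleftrightarrow>
     Ck_on_subset 1 (frontier (domO D) \<times> setV D) (\<lambda>(x, b). gamma D x b) \<and>
     (\<forall>x\<in>frontier (domO D). \<forall>b\<in>setB D. norm (gamma D x b) = 1 \<and> 0 < normal D x \<bullet> gamma D x b)"


section \<open>Projection along the oblique direction\<close>

definition tube :: "'a::metric_space set \<Rightarrow> real \<Rightarrow> 'a set" where
  "tube \<Omega> R = {x. infdist x (frontier \<Omega>) < R}"

definition oblique_decomposition ::
    "('n::finite, 'm::finite, 'p::finite, 'q::finite) control_data \<Rightarrow> real \<Rightarrow>
     (real^'n \<Rightarrow> real^'q \<Rightarrow> real^'n) \<Rightarrow> (real^'n \<Rightarrow> real^'q \<Rightarrow> real) \<Rightarrow> bool" where
  "oblique_decomposition D R pg dg \<longleftrightarrow>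
     Ck_on_subset 1 (tube (domO D) R \<times> setB D) (\<lambda>(x, b). pg x b) \<and>
     Ck_on_subset 1 (tube (domO D) R \<times> setB D) (\<lambda>(x, b). dg x b) \<and>
     (\<forall>x\<in>tube (domO D) R. \<forall>b\<in>setB D.
        pg x b \<in> frontier (domO D) \<and> x = pg x b + dg x b *\<^sub>R gamma D (pg x b) b) \<and>
     (\<forall>x\<in>frontier (domO D). \<forall>b\<in>setB D. dg x b = 0)"

definition unique_oblique_decomposition ::
    "('n::finite, 'm::finite, 'p::finite, 'q::finite) control_data \<Rightarrow> real \<Rightarrow>
     (real^'n \<Rightarrow> real^'q \<Rightarrow> real^'n) \<Rightarrow> (real^'n \<Rightarrow> real^'q \<Rightarrow> real) \<Rightarrow> bool" where
  "unique_oblique_decomposition D R pg dg \<longleftrightarrow> oblique_decomposition D R pg dg \<and>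
     (\<forall>pg' dg'. oblique_decomposition D R pg' dg' \<longrightarrow>
        (\<forall>x\<in>tube (domO D) R. \<forall>b\<in>setB D. pg' x b = pg x b \<and> dg' x b = dg x b))"


section \<open>Meshes and interpolation\<close>

text \<open>The simplices are closed sets and their vertices are their extreme points. \<open>curved T\<close>
  is the element of the exact triangulation that corresponds to the simplex \<open>T\<close>;
  \<open>vertex i\<close> and \<open>basis_fun i\<close> are used for \<open>i \<in> {1..num_vertices}\<close>.\<close>

record 'n mesh =
  mesh_domain :: "(real^'n) set"
  simplices :: "(real^'n) set set"
  num_vertices :: nat
  vertex :: "nat \<Rightarrow> real^'n"
  curved :: "(real^'n) set \<Rightarrow> (real^'n) set"
  mesh_proj :: "real^'n \<Rightarrow> real^'n"
  basis_fun :: "nat \<Rightarrow> real^'n \<Rightarrow> real"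

definition node_ids :: "'n::finite mesh \<Rightarrow> nat set" where
  "node_ids M = {1..num_vertices M}"

definition nodes :: "'n::finite mesh \<Rightarrow> (real^'n) set" where
  "nodes M = vertex M ` node_ids M"

text \<open>The library notion \<open>polyhedron\<close> is convex, a polyhedral domain need not be.\<close>

definition polyhedral_domain :: "'a::euclidean_space set \<Rightarrow> bool" where
  "polyhedral_domain \<Omega> \<longleftrightarrow> \<Omega> \<noteq> {} \<and> open \<Omega> \<and> connected \<Omega> \<and> bounded \<Omega> \<and>
     (\<exists>P. finite P \<and> (\<forall>F\<in>P. polytope F \<and> aff_dim F = int DIM('a) - 1) \<and> frontier \<Omega> = \<Union>P)"

definition mesh_triangulation :: "'n::finite mesh \<Rightarrow> bool" where
  "mesh_triangulation M \<longleftrightarrow>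
     polyhedral_domain (mesh_domain M) \<and>
     triangulation (simplices M) \<and> (\<forall>S\<in>simplices M. int CARD('n) simplex S) \<and>
     closure (mesh_domain M) = \<Union>(simplices M) \<and>
     inj_on (vertex M) (node_ids M) \<and>
     nodes M = {v. \<exists>S\<in>simplices M. v extreme_point_of S}"

text \<open>A facet of an element with vertices on the boundary ``intersects'' the boundary when it
  does so in its relative interior: the facets of an element that contain a given boundary
  vertex all meet the boundary at that vertex.\<close>

definition boundary_fitted :: "(real^'n::finite) set \<Rightarrow> 'n mesh \<Rightarrow> bool" where
  "boundary_fitted \<Omega> M \<longleftrightarrow>
     (\<forall>v\<in>nodes M. v \<in> frontier (mesh_domain M) \<longrightarrow> v \<in> frontier \<Omega>) \<and>
     (\<forall>S\<in>simplices M. \<forall>F F'.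
        F facet_of S \<and> (\<forall>v. v extreme_point_of F \<longrightarrow> v \<in> frontier (mesh_domain M)) \<and>
          rel_interior F \<inter> frontier (mesh_domain M) \<noteq> {} \<and>
        F' facet_of S \<and> (\<forall>v. v extreme_point_of F' \<longrightarrow> v \<in> frontier (mesh_domain M)) \<and>
          rel_interior F' \<inter> frontier (mesh_domain M) \<noteq> {} \<longrightarrow> F = F')"

text \<open>A curved element is a homeomorphic image \<open>h S ` S\<close> of its simplex with the same vertices,
  and two curved elements meet in the image of the common face of their simplices. The boundary
  elements, which may be curved, are those that meet the boundary of the polyhedral domain.\<close>

definition exact_triangulation :: "(real^'n::finite) set \<Rightarrow> 'n mesh \<Rightarrow> bool" where
  "exact_triangulation \<Omega> M \<longleftrightarrow>
     closure \<Omega> = (\<Union>S\<in>simplices M. curved M S) \<and>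
     inj_on (curved M) (simplices M) \<and>
     (\<exists>h. (\<forall>S\<in>simplices M.
             continuous_on S (h S) \<and> inj_on (h S) S \<and> h S ` S = curved M S \<and>
             (\<forall>v. v extreme_point_of S \<longrightarrow> h S v = v)) \<and>
          (\<forall>S\<in>simplices M. \<forall>S'\<in>simplices M. curved M S \<inter> curved M S' = h S ` (S \<inter> S'))) \<and>
     (\<forall>S\<in>simplices M. S \<inter> frontier (mesh_domain M) = {} \<longrightarrow> curved M S = S)"

definition is_mesh_projection :: "(real^'n::finite) set \<Rightarrow> 'n mesh \<Rightarrow> bool" where
  "is_mesh_projection \<Omega> M \<longleftrightarrow>
     mesh_proj M ` closure \<Omega> \<subseteq> closure (mesh_domain M) \<inter> closure \<Omega> \<and>
     (\<forall>S\<in>simplices M. \<forall>x\<in>curved M S. mesh_proj M x = closest_point S x)"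

definition is_P1_basis :: "'n::finite mesh \<Rightarrow> bool" where
  "is_P1_basis M \<longleftrightarrow> (\<forall>i\<in>node_ids M.
     continuous_on (closure (mesh_domain M)) (basis_fun M i) \<and>
     (\<forall>S\<in>simplices M. \<exists>w c. \<forall>x\<in>S. basis_fun M i x = w \<bullet> x + c) \<and>
     (\<forall>j\<in>node_ids M. basis_fun M i (vertex M j) = (if i = j then 1 else 0)))"

definition admissible_mesh ::
    "(real^'n::finite) set \<Rightarrow> real \<Rightarrow> real \<Rightarrow> real \<Rightarrow> 'n mesh \<Rightarrow> bool" where
  "admissible_mesh \<Omega> \<delta> C \<Delta>x M \<longleftrightarrow>
     mesh_triangulation M \<and> \<Delta>x = Max (diameter ` simplices M) \<and>
     boundary_fitted \<Omega> M \<and>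
     (\<forall>S\<in>simplices M. (\<exists>z. S \<subseteq> ball z (\<Delta>x / \<delta>)) \<and> (\<exists>z. ball z (\<delta> * \<Delta>x) \<subseteq> S)) \<and>
     exact_triangulation \<Omega> M \<and>
     is_mesh_projection \<Omega> M \<and>
     (\<forall>x\<in>closure \<Omega>. norm (x - mesh_proj M x) \<le> C * \<Delta>x\<^sup>2) \<and>
     is_P1_basis M"

definition mesh_family :: "(real^'n::finite) set \<Rightarrow> real set \<Rightarrow> (real \<Rightarrow> 'n mesh) \<Rightarrow> bool" where
  "mesh_family \<Omega> H M \<longleftrightarrow> H \<subseteq> {0<..} \<and> 0 islimpt H \<and>
     (\<exists>\<delta> C. 0 < \<delta> \<and> \<delta> < 1 \<and> 0 < C \<and> (\<forall>\<Delta>x\<in>H. admissible_mesh \<Omega> \<delta> C \<Delta>x (M \<Delta>x)))"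

definition interp :: "'n::finite mesh \<Rightarrow> (real^'n \<Rightarrow> real) \<Rightarrow> real^'n \<Rightarrow> real" where
  "interp M \<phi> x = (\<Sum>i\<in>node_ids M. basis_fun M i (mesh_proj M x) * \<phi> (vertex M i))"


section \<open>The scheme\<close>

definition num_steps :: "real \<Rightarrow> real \<Rightarrow> nat" where
  "num_steps T \<Delta>t = nat \<lfloor>T / \<Delta>t\<rfloor>"

definition time_pt :: "real \<Rightarrow> nat \<Rightarrow> real" where
  "time_pt \<Delta>t k = real k * \<Delta>t"

text \<open>The index set \<open>{+,-} \<times> {1,...,N\<^sub>\<sigma>}\<close>, with the signs encoded as the reals \<open>1\<close> and \<open>-1\<close>.\<close>

definition branches :: "(real \<times> 'm::finite) set" where
  "branches = {1, -1} \<times> UNIV"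

definition char_pt ::
    "('n::finite, 'm::finite, 'p::finite, 'q::finite) control_data \<Rightarrow> 'n mesh \<Rightarrow> real \<Rightarrow>
     nat \<Rightarrow> nat \<Rightarrow> real \<times> 'm \<Rightarrow> real^'p \<Rightarrow> real^'n" where
  "char_pt D M \<Delta>t k i s a =
     vertex M i + \<Delta>t *\<^sub>R mu D (time_pt \<Delta>t k) (vertex M i) a
       + (fst s * sqrt (real CARD('m) * \<Delta>t)) *\<^sub>R
           column (snd s) (sigma D (time_pt \<Delta>t k) (vertex M i) a)"

definition refl_pt ::
    "('n::finite, 'm::finite, 'p::finite, 'q::finite) control_data \<Rightarrow>
     (real^'n \<Rightarrow> real^'q \<Rightarrow> real^'n) \<Rightarrow> real \<Rightarrow> 'n mesh \<Rightarrow> real \<Rightarrow>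
     nat \<Rightarrow> nat \<Rightarrow> real \<times> 'm \<Rightarrow> real^'p \<Rightarrow> real^'q \<Rightarrow> real^'n" where
  "refl_pt D pg cbar M \<Delta>t k i s a b =
     (let y = char_pt D M \<Delta>t k i s a in
       if y \<in> closure (domO D) then y
       else pg y b - (cbar * sqrt \<Delta>t) *\<^sub>R gamma D (pg y b) b)"

definition refl_dist ::
    "('n::finite, 'm::finite, 'p::finite, 'q::finite) control_data \<Rightarrow>
     (real^'n \<Rightarrow> real^'q \<Rightarrow> real) \<Rightarrow> real \<Rightarrow> 'n mesh \<Rightarrow> real \<Rightarrow>
     nat \<Rightarrow> nat \<Rightarrow> real \<times> 'm \<Rightarrow> real^'p \<Rightarrow> real^'q \<Rightarrow> real" where
  "refl_dist D dg cbar M \<Delta>t k i s a b =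
     (let y = char_pt D M \<Delta>t k i s a in
       if y \<in> closure (domO D) then 0 else dg y b + cbar * sqrt \<Delta>t)"

definition refl_cost ::
    "('n::finite, 'm::finite, 'p::finite, 'q::finite) control_data \<Rightarrow>
     (real^'n \<Rightarrow> real^'q \<Rightarrow> real^'n) \<Rightarrow> 'n mesh \<Rightarrow> real \<Rightarrow>
     nat \<Rightarrow> nat \<Rightarrow> real \<times> 'm \<Rightarrow> real^'p \<Rightarrow> real^'q \<Rightarrow> real" where
  "refl_cost D pg M \<Delta>t k i s a b =
     (let y = char_pt D M \<Delta>t k i s a in
       if y \<in> closure (domO D) then 0 else gcost D (time_pt \<Delta>t k) (pg y b) b)"

text \<open>The characteristics that leave the closed domain stay in the tube, where the oblique
  projection is defined, and are reflected back into the closed domain.\<close>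

definition scheme_well_defined ::
    "('n::finite, 'm::finite, 'p::finite, 'q::finite) control_data \<Rightarrow> real \<Rightarrow>
     (real^'n \<Rightarrow> real^'q \<Rightarrow> real^'n) \<Rightarrow> real \<Rightarrow> 'n mesh \<Rightarrow> real \<Rightarrow> bool" where
  "scheme_well_defined D R pg cbar M \<Delta>t \<longleftrightarrow>
     (\<forall>k<num_steps (horizon D) \<Delta>t. \<forall>i\<in>node_ids M. \<forall>a\<in>setA D. \<forall>b\<in>setB D. \<forall>s\<in>branches.
        char_pt D M \<Delta>t k i s a \<notin> closure (domO D) \<longrightarrow>
          char_pt D M \<Delta>t k i s a \<in> tube (domO D) R \<and>
          refl_pt D pg cbar M \<Delta>t k i s a b \<in> closure (domO D))"

definition scheme_op ::
    "('n::finite, 'm::finite, 'p::finite, 'q::finite) control_data \<Rightarrow>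
     (real^'n \<Rightarrow> real^'q \<Rightarrow> real^'n) \<Rightarrow> (real^'n \<Rightarrow> real^'q \<Rightarrow> real) \<Rightarrow> real \<Rightarrow> 'n mesh \<Rightarrow> real \<Rightarrow>
     nat \<Rightarrow> nat \<Rightarrow> (real^'n \<Rightarrow> real) \<Rightarrow> real^'p \<Rightarrow> real^'q \<Rightarrow> real" where
  "scheme_op D pg dg cbar M \<Delta>t k i \<Phi> a b =
     1 / (2 * real CARD('m)) *
       (\<Sum>s\<in>branches. interp M \<Phi> (refl_pt D pg cbar M \<Delta>t k i s a b)
          + refl_dist D dg cbar M \<Delta>t k i s a b * refl_cost D pg M \<Delta>t k i s a b)
     + \<Delta>t * fcost D (time_pt \<Delta>t k) (vertex M i) a"

end

theory Submission
  imports Defs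
begin

text \<open>Both properties come from one fact about the interpolation: at every point of the closed
  domain, \<open>interp M\<close> evaluates to a convex combination, with weights independent of the grid
  function, of the nodal values. The weights are the values of the basis functions at the
  projected point. That point lies in a simplex, a simplex is the convex hull of its extreme
  points, and the extreme points are nodes, where the basis functions take the values \<open>0\<close>
  and \<open>1\<close>. Affine functions transport nonnegativity and the partition of unity from the extreme
  points to the whole simplex (\<open>basis_fun_nonneg\<close>, \<open>sum_basis_fun\<close>).

  The operator averages the interpolant over the \<open>2 N\<^sub>\<sigma>\<close> branches, with equal positive
  weights, and adds terms that do not involve the grid function. What has to be checked is that
  the interpolant is evaluated only in the closed domain: a characteristic that ends there is kept,
  and one that leaves it is reflected back by well-definedness (\<open>refl_pt_in_closure\<close>).\<close>

text \<open>By Krein--Milman. An affine inequality or equation defines a convex \<open>K\<close>, so on a simplex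
  it needs to be verified only at the extreme points.\<close>

lemma simplex_subset_if_extreme_points_subset:
  assumes "n simplex S" and "\<And>v. v extreme_point_of S \<Longrightarrow> v \<in> K" and "convex K"
  shows "S \<subseteq> K"
proof -
  have "S = convex hull {v. v extreme_point_of S}"
    using assms(1) by (intro Krein_Milman_Minkowski compact_simplex convex_simplex)
  also have "\<dots> \<subseteq> K"
    using assms(2,3) by (intro hull_minimal) auto
  finally show ?thesis .
qed

lemma basis_fun_at_node:
  assumes "is_P1_basis M" and "i \<in> node_ids M" and "j \<in> node_ids M"
  shows "basis_fun M i (vertex M j) = (if i = j then 1 else 0)"
  using assms by (simp add: is_P1_basis_def)

lemma basis_fun_affine:
  assumes "is_P1_basis M" and "i \<in> node_ids M" and "S \<in> simplices M"
  obtains w c where "\<And>x. x \<in> S \<Longrightarrow> basis_fun M i x = w \<bullet> x + c"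
proof -
  have "\<exists>w c. \<forall>x\<in>S. basis_fun M i x = w \<bullet> x + c"
    using assms by (simp add: is_P1_basis_def)
  then show thesis
    using that by blast
qed

lemma extreme_point_is_vertex:
  assumes "mesh_triangulation M" and "S \<in> simplices M" and "v extreme_point_of S"
  obtains j where "j \<in> node_ids M" and "v = vertex M j"
proof -
  have "v \<in> nodes M"
    using assms unfolding mesh_triangulation_def by blast
  then show thesis
    using that unfolding nodes_def by blast
qed

lemma basis_fun_nonneg:
  assumes mesh: "mesh_triangulation M" and basis: "is_P1_basis M"
    and i: "i \<in> node_ids M" and S: "S \<in> simplices M" and x: "x \<in> S"
  shows "0 \<le> basis_fun M i x"
proof -
  obtain w c where wc: "\<And>x. x \<in> S \<Longrightarrow> basis_fun M i x = w \<bullet> x + c"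
    using basis_fun_affine[OF basis i S] by blast
  have "S \<subseteq> {x. w \<bullet> x \<ge> - c}"
  proof (rule simplex_subset_if_extreme_points_subset)
    show "int CARD('a) simplex S"
      using mesh S unfolding mesh_triangulation_def by blast
  next
    fix v assume v: "v extreme_point_of S"
    then obtain j where j: "j \<in> node_ids M" "v = vertex M j"
      using extreme_point_is_vertex[OF mesh S] by blast
    have "0 \<le> basis_fun M i v"
      using basis_fun_at_node[OF basis i j(1)] j(2) by simp
    then show "v \<in> {x. w \<bullet> x \<ge> - c}"
      using wc v by (simp add: extreme_point_of_def)
  qed (rule convex_halfspace_ge)
  then show ?thesis
    using wc x by force
qed

text \<open>The sum of the basis functions is again affine on \<open>S\<close>. At an extreme point of \<open>S\<close>, which is
  a node, exactly one term is \<open>1\<close> and the others vanish.\<close>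

lemma sum_basis_fun:
  assumes mesh: "mesh_triangulation M" and basis: "is_P1_basis M"
    and S: "S \<in> simplices M" and x: "x \<in> S"
  shows "(\<Sum>i\<in>node_ids M. basis_fun M i x) = 1"
proof -
  have "\<forall>i\<in>node_ids M. \<exists>w c. \<forall>x\<in>S. basis_fun M i x = w \<bullet> x + c"
    using basis S by (simp add: is_P1_basis_def)
  then obtain w c where wc: "\<And>i x. i \<in> node_ids M \<Longrightarrow> x \<in> S \<Longrightarrow> basis_fun M i x = w i \<bullet> x + c i"
    by metis
  define W where "W = (\<Sum>i\<in>node_ids M. w i)"
  define K where "K = (\<Sum>i\<in>node_ids M. c i)"
  have sum: "(\<Sum>i\<in>node_ids M. basis_fun M i x) = W \<bullet> x + K" if "x \<in> S" for x
    using that by (simp add: wc W_def K_def inner_sum_left sum.distrib)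
  have "S \<subseteq> {x. W \<bullet> x = 1 - K}"
  proof (rule simplex_subset_if_extreme_points_subset)
    show "int CARD('a) simplex S"
      using mesh S unfolding mesh_triangulation_def by blast
  next
    fix v assume v: "v extreme_point_of S"
    then obtain j where j: "j \<in> node_ids M" "v = vertex M j"
      using extreme_point_is_vertex[OF mesh S] by blast
    have "(\<Sum>i\<in>node_ids M. basis_fun M i v) = (\<Sum>i\<in>node_ids M. if i = j then 1 else 0)"
      using basis_fun_at_node[OF basis _ j(1)] j(2) by (intro sum.cong) auto
    also have "\<dots> = 1"
      using j(1) by (simp add: node_ids_def)
    finally show "v \<in> {x. W \<bullet> x = 1 - K}"
      using sum[of v] v by (simp add: extreme_point_of_def)
  qed (rule convex_hyperplane)
  then show ?thesis
    using sum[OF x] x by force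
qed

text \<open>The projection takes values in the closed polyhedral domain, which the simplices cover.\<close>

lemma mesh_proj_in_simplex:
  assumes "admissible_mesh \<Omega> \<delta> C h M" and "x \<in> closure \<Omega>"
  obtains S where "S \<in> simplices M" and "mesh_proj M x \<in> S"
proof -
  have "mesh_proj M x \<in> closure (mesh_domain M)"
    using assms by (auto simp: admissible_mesh_def is_mesh_projection_def)
  also have "\<dots> = \<Union>(simplices M)"
    using assms(1) by (simp add: admissible_mesh_def mesh_triangulation_def)
  finally show thesis
    using that by blast
qed

lemma interp_mono:
  assumes mesh: "admissible_mesh \<Omega> \<delta> C h M" and x: "x \<in> closure \<Omega>"
    and le: "\<And>z. z \<in> nodes M \<Longrightarrow> U z \<le> V z"
  shows "interp M U x \<le> interp M V x"
proof -
  obtain S where S: "S \<in> simplices M" "mesh_proj M x \<in> S"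
    using mesh_proj_in_simplex[OF mesh x] by blast
  show ?thesis
    unfolding interp_def
  proof (intro sum_mono mult_left_mono)
    fix i assume i: "i \<in> node_ids M"
    then show "U (vertex M i) \<le> V (vertex M i)"
      by (intro le) (simp add: nodes_def)
    show "0 \<le> basis_fun M i (mesh_proj M x)"
      using mesh i S by (intro basis_fun_nonneg) (simp_all add: admissible_mesh_def)
  qed
qed

lemma interp_add_const:
  assumes mesh: "admissible_mesh \<Omega> \<delta> C h M" and x: "x \<in> closure \<Omega>"
  shows "interp M (\<lambda>z. U z + c) x = interp M U x + c"
proof -
  obtain S where S: "S \<in> simplices M" "mesh_proj M x \<in> S"
    using mesh_proj_in_simplex[OF mesh x] by blast
  have "(\<Sum>i\<in>node_ids M. basis_fun M i (mesh_proj M x)) = 1"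
    using mesh S by (intro sum_basis_fun) (simp_all add: admissible_mesh_def)
  then show ?thesis
    by (simp add: interp_def distrib_left sum.distrib flip: sum_distrib_right)
qed

lemma refl_pt_in_closure:
  assumes "scheme_well_defined D R pg cbar M \<Delta>t" and "k < num_steps (horizon D) \<Delta>t"
    and "i \<in> node_ids M" and "a \<in> setA D" and "b \<in> setB D" and "s \<in> branches"
  shows "refl_pt D pg cbar M \<Delta>t k i s a b \<in> closure (domO D)"
proof (cases "char_pt D M \<Delta>t k i s a \<in> closure (domO D)")
  case True
  then show ?thesis by (simp add: refl_pt_def)
next
  case False
  then show ?thesis using assms by (simp add: scheme_well_defined_def)
qed

lemma scheme_op_mono:
  fixes D :: "('n::finite, 'm::finite, 'p::finite, 'q::finite) control_data"
  assumes "\<And>s. s \<in> branches \<Longrightarrow>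
      interp M U (refl_pt D pg cbar M \<Delta>t k i s a b) \<le> interp M V (refl_pt D pg cbar M \<Delta>t k i s a b)"
  shows "scheme_op D pg dg cbar M \<Delta>t k i U a b \<le> scheme_op D pg dg cbar M \<Delta>t k i V a b"
  unfolding scheme_op_def
  by (intro add_right_mono mult_left_mono sum_mono assms) simp_all

lemma card_branches: "card (branches :: (real \<times> 'm::finite) set) = 2 * CARD('m)"
  by (simp add: branches_def card_cartesian_product)

text \<open>The factor \<open>1 / (2 N\<^sub>\<sigma>)\<close> is the reciprocal of the number of branches, so that the
  constant, which every branch contributes once, is averaged to itself.\<close>

lemma scheme_op_add_const:
  fixes D :: "('n::finite, 'm::finite, 'p::finite, 'q::finite) control_data"
  assumes "\<And>s. s \<in> branches \<Longrightarrow>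
      interp M V (refl_pt D pg cbar M \<Delta>t k i s a b)
        = interp M U (refl_pt D pg cbar M \<Delta>t k i s a b) + c"
  shows "scheme_op D pg dg cbar M \<Delta>t k i V a b = scheme_op D pg dg cbar M \<Delta>t k i U a b + c"
proof -
  have "(\<Sum>s\<in>branches. interp M V (refl_pt D pg cbar M \<Delta>t k i s a b)
          + refl_dist D dg cbar M \<Delta>t k i s a b * refl_cost D pg M \<Delta>t k i s a b)
      = (\<Sum>s\<in>branches. interp M U (refl_pt D pg cbar M \<Delta>t k i s a b)
          + refl_dist D dg cbar M \<Delta>t k i s a b * refl_cost D pg M \<Delta>t k i s a b)
        + 2 * real CARD('m) * c"
    by (simp add: assms sum.distrib card_branches)
  then show ?thesis
    by (simp add: scheme_op_def distrib_left)
qed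

theorem proposition4p1:
  fixes D :: "('n::finite, 'm::finite, 'p::finite, 'q::finite) control_data"
    and pg :: "real^'n \<Rightarrow> real^'q \<Rightarrow> real^'n" and dg :: "real^'n \<Rightarrow> real^'q \<Rightarrow> real"
    and M :: "real \<Rightarrow> 'n mesh" and H :: "real set"
    and R cbar \<Delta>t_max \<Delta>t \<Delta>x :: real
  assumes data: "basic_data D"
    and domain: "domain_assumption D"
    and coefficients: "coefficient_assumption D"
    and oblique: "oblique_assumption D"
    and meshes: "mesh_family (domO D) H M"
    and decomposition: "0 < R" "unique_oblique_decomposition D R pg dg"
    and cbar: "0 < cbar"
    and mesh_size: "\<Delta>x \<in> H"
    and well_defined: "0 < \<Delta>t_max"
      "\<forall>\<tau>\<in>{0<..\<Delta>t_max}. scheme_well_defined D R pg cbar (M \<Delta>x) \<tau>"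
    and time_step: "\<Delta>t \<in> {0<..\<Delta>t_max}"
  shows "(\<forall>U V. (\<forall>z\<in>nodes (M \<Delta>x). U z \<le> V z) \<longrightarrow>
            (\<forall>k<num_steps (horizon D) \<Delta>t. \<forall>i\<in>node_ids (M \<Delta>x). \<forall>a\<in>setA D. \<forall>b\<in>setB D.
               scheme_op D pg dg cbar (M \<Delta>x) \<Delta>t k i U a b
                 \<le> scheme_op D pg dg cbar (M \<Delta>x) \<Delta>t k i V a b))
       \<and> (\<forall>c U. \<forall>k<num_steps (horizon D) \<Delta>t. \<forall>i\<in>node_ids (M \<Delta>x). \<forall>a\<in>setA D. \<forall>b\<in>setB D.
            scheme_op D pg dg cbar (M \<Delta>x) \<Delta>t k i (\<lambda>z. U z + c) a b
              = scheme_op D pg dg cbar (M \<Delta>x) \<Delta>t k i U a b + c)"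
proof -
  obtain \<delta> C where mesh: "admissible_mesh (domO D) \<delta> C \<Delta>x (M \<Delta>x)"
    using meshes mesh_size unfolding mesh_family_def by blast
  have "scheme_well_defined D R pg cbar (M \<Delta>x) \<Delta>t"
    using well_defined(2) time_step by blast
  note in_closure = refl_pt_in_closure[OF this]
  show ?thesis
    by (intro conjI allI impI ballI scheme_op_mono scheme_op_add_const
          interp_mono[OF mesh] interp_add_const[OF mesh] in_closure) blast+
qed

end
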